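(* Let $V$ be a separable right quaternionic Hilbert space and let $\{u_i\}_{i\in I}$ be a sequence in $V$. Then $\{u_i\}_{i\in I}$ is a frame for $V$ if and only if the right linear operator $$T(\{q_i\}_{i\in I})=\sum_{i\in I}u_iq_i,\qquad \{q_i\}_{i\in I}\in\ell_2(\mathfrak{Q}),$$ is a well-defined and bounded mapping from $\ell_2(\mathfrak{Q})$ onto $V$.
   Context: $\mathfrak{Q}$ denotes the (non-commutative) field of real quaternions, with conjugation $\overline{q}$ and modulus $|q|=(\overline{q}q)^{1/2}$. A right quaternionic Hilbert space $V$ is a right $\mathfrak{Q}$-vector space with an inner product $\langle\cdot|\cdot\rangle:V\times V\to\mathfrak{Q}$ satisfying $\overline{\langle v|w\rangle}=\langle w|v\rangle$, $\langle v|v\rangle>0$ for $v\neq0$, additivity in the second argument, and $\langle v|uq\rangle=\langle v|u\rangle q$ for $q\in\mathfrak{Q}$ (hence $\langle vq|u\rangle=\overline{q}\langle v|u\rangle$), and which is complete for the norm $\|u\|=\sqrt{\langle u|u\rangle}$. Right linear means right $\mathfrak{Q}$-linear: $T(v\alpha+w\beta)=T(v)\alpha+T(w)\beta$. $I$ is a nonempty index set. A sum over $I$ of nonnegative reals is the supremum (in $[0,+\infty]$) of its finite partial sums; a series of vectors over $I$ is understood to converge in norm unconditionally, i.e. as the limit of the net of finite partial sums. $\ell_2(\mathfrak{Q})$ is the right quaternionic Hilbert space of families $\{q_i\}_{i\in I}\subset\mathfrak{Q}$ with $\sum_{i\in I}|q_i|^2<+\infty$, with inner product $\langle p|q\rangle=\sum_{i\in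 I}\overline{p_i}q_i$. "Well defined" for $T$ means that the series converges for every $\{q_i\}\in\ell_2(\mathfrak{Q})$. $\{u_i\}_{i\in I}\subset V$ is a frame for $V$ if there are finite constants $0<A\le B$ with $A\|u\|^2\le\sum_{i\in I}|\langle u_i|u\rangle|^2\le B\|u\|^2$ for all $u\in V$. *)

theory Defs
  imports "HOL-Analysis.Analysis"
begin

section \<open>Real quaternions\<close>

text \<open>\<open>Quat a b c d\<close> stands for $a + bi + cj + dk$.\<close>

datatype quat = Quat (qRe: real) (qIm1: real) (qIm2: real) (qIm3: real)

lemma quat_eq_iff:
  "p = q \<longleftrightarrow> qRe p = qRe q \<and> qIm1 p = qIm1 q \<and> qIm2 p = qIm2 q \<and> qIm3 p = qIm3 q"
  by (cases p; cases q) simp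

instantiation quat :: ab_group_add
begin
definition "0 = Quat 0 0 0 0"
definition "p + q = Quat (qRe p + qRe q) (qIm1 p + qIm1 q) (qIm2 p + qIm2 q) (qIm3 p + qIm3 q)"
definition "p - q = Quat (qRe p - qRe q) (qIm1 p - qIm1 q) (qIm2 p - qIm2 q) (qIm3 p - qIm3 q)"
definition "- q = Quat (- qRe q) (- qIm1 q) (- qIm2 q) (- qIm3 q)"
instance
  by standard
    (auto simp: zero_quat_def plus_quat_def minus_quat_def uminus_quat_def)
end

lemma quat_add_sel [simp]:
  "qRe 0 = 0" "qIm1 0 = 0" "qIm2 0 = 0" "qIm3 0 = 0"
  "qRe (p + q) = qRe p + qRe q" "qIm1 (p + q) = qIm1 p + qIm1 q"
  "qIm2 (p + q) = qIm2 p + qIm2 q" "qIm3 (p + q) = qIm3 p + qIm3 q"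
  "qRe (p - q) = qRe p - qRe q" "qIm1 (p - q) = qIm1 p - qIm1 q"
  "qIm2 (p - q) = qIm2 p - qIm2 q" "qIm3 (p - q) = qIm3 p - qIm3 q"
  "qRe (- q) = - qRe q" "qIm1 (- q) = - qIm1 q"
  "qIm2 (- q) = - qIm2 q" "qIm3 (- q) = - qIm3 q"
  by (simp_all add: zero_quat_def plus_quat_def minus_quat_def uminus_quat_def)

instantiation quat :: real_vector
begin
definition "r *\<^sub>R q = Quat (r * qRe q) (r * qIm1 q) (r * qIm2 q) (r * qIm3 q)"
instance
  by standard (auto simp: scaleR_quat_def quat_eq_iff algebra_simps)
end

lemma quat_scaleR_sel [simp]:
  "qRe (r *\<^sub>R q) = r * qRe q" "qIm1 (r *\<^sub>R q) = r * qIm1 q"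
  "qIm2 (r *\<^sub>R q) = r * qIm2 q" "qIm3 (r *\<^sub>R q) = r * qIm3 q"
  by (simp_all add: scaleR_quat_def)

instantiation quat :: real_algebra_1
begin
definition "1 = Quat 1 0 0 0"
definition "p * q = Quat
  (qRe p * qRe q - qIm1 p * qIm1 q - qIm2 p * qIm2 q - qIm3 p * qIm3 q)
  (qRe p * qIm1 q + qIm1 p * qRe q + qIm2 p * qIm3 q - qIm3 p * qIm2 q)
  (qRe p * qIm2 q - qIm1 p * qIm3 q + qIm2 p * qRe q + qIm3 p * qIm1 q)
  (qRe p * qIm3 q + qIm1 p * qIm2 q - qIm2 p * qIm1 q + qIm3 p * qRe q)"
instance
  by standard (auto simp: one_quat_def times_quat_def quat_eq_iff algebra_simps)
end

lemma quat_one_sel [simp]: "qRe 1 = 1" "qIm1 1 = 0" "qIm2 1 = 0" "qIm3 1 = 0"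
  by (simp_all add: one_quat_def)

lemma quat_mult_sel:
  "qRe (p * q) = qRe p * qRe q - qIm1 p * qIm1 q - qIm2 p * qIm2 q - qIm3 p * qIm3 q"
  "qIm1 (p * q) = qRe p * qIm1 q + qIm1 p * qRe q + qIm2 p * qIm3 q - qIm3 p * qIm2 q"
  "qIm2 (p * q) = qRe p * qIm2 q - qIm1 p * qIm3 q + qIm2 p * qRe q + qIm3 p * qIm1 q"
  "qIm3 (p * q) = qRe p * qIm3 q + qIm1 p * qIm2 q - qIm2 p * qIm1 q + qIm3 p * qRe q"
  by (simp_all add: times_quat_def)

lemma quat_of_real_sel [simp]:
  "qRe (of_real r) = r" "qIm1 (of_real r) = 0" "qIm2 (of_real r) = 0" "qIm3 (of_real r) = 0"
  by (simp_all add: of_real_def)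

definition qcnj :: "quat \<Rightarrow> quat" where
  "qcnj q = Quat (qRe q) (- qIm1 q) (- qIm2 q) (- qIm3 q)"

lemma qcnj_sel [simp]:
  "qRe (qcnj q) = qRe q" "qIm1 (qcnj q) = - qIm1 q"
  "qIm2 (qcnj q) = - qIm2 q" "qIm3 (qcnj q) = - qIm3 q"
  by (simp_all add: qcnj_def)

lemma qcnj_mult: "qcnj (p * q) = qcnj q * qcnj p"
  by (simp add: quat_eq_iff quat_mult_sel algebra_simps)

lemma qcnj_qcnj [simp]: "qcnj (qcnj q) = q"
  by (simp add: quat_eq_iff)

instantiation quat :: real_inner
begin
definition inner_quat_def:
  "inner p q = qRe p * qRe q + qIm1 p * qIm1 q + qIm2 p * qIm2 q + qIm3 p * qIm3 q"
definition norm_quat_def: "norm (q :: quat) = sqrt (inner q q)"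
definition dist_quat_def: "dist p q = norm (p - q :: quat)"
definition sgn_quat_def: "sgn q = (q :: quat) /\<^sub>R norm q"
definition uniformity_quat_def [code del]:
  "(uniformity :: (quat \<times> quat) filter) = (INF e\<in>{0 <..}. principal {(x, y). dist x y < e})"
definition open_quat_def [code del]:
  "open (U :: quat set) \<longleftrightarrow> (\<forall>x\<in>U. eventually (\<lambda>(x', y). x' = x \<longrightarrow> y \<in> U) uniformity)"
instance
proof
  fix x y z :: quat and r :: real
  show "(inner x x = 0) = (x = 0)"
  proof
    assume "inner x x = 0"
    then have "(qRe x)\<^sup>2 + (qIm1 x)\<^sup>2 + (qIm2 x)\<^sup>2 + (qIm3 x)\<^sup>2 = 0"
      by (simp add: inner_quat_def power2_eq_square)
    then show "x = 0"
      by (simp add: quat_eq_iff add_nonneg_eq_0_iff)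
  qed (simp add: inner_quat_def)
qed (simp_all add: inner_quat_def norm_quat_def dist_quat_def sgn_quat_def
      uniformity_quat_def open_quat_def algebra_simps)
end

lemma norm_quat_sq: "(norm q)\<^sup>2 = (qRe q)\<^sup>2 + (qIm1 q)\<^sup>2 + (qIm2 q)\<^sup>2 + (qIm3 q)\<^sup>2"
  unfolding power2_norm_eq_inner inner_quat_def by (simp only: power2_eq_square)

lemma qcnj_mult_self: "qcnj q * q = of_real ((norm q)\<^sup>2)"
  unfolding norm_quat_sq by (simp add: quat_eq_iff quat_mult_sel power2_eq_square)

lemma mult_qcnj_self: "q * qcnj q = of_real ((norm q)\<^sup>2)"
  unfolding norm_quat_sq by (simp add: quat_eq_iff quat_mult_sel power2_eq_square)

lemma norm_qcnj [simp]: "norm (qcnj q) = norm q"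
  by (simp add: norm_quat_def inner_quat_def)

instantiation quat :: real_normed_div_algebra
begin
definition inverse_quat_def: "inverse q = qcnj q /\<^sub>R (norm q)\<^sup>2"
definition divide_quat_def: "p div q = p * inverse q" for p q :: quat
instance
proof
  fix x y :: quat
  show "inverse x * x = 1" if "x \<noteq> 0"
    using that by (simp add: inverse_quat_def qcnj_mult_self of_real_def del: of_real_power)
  show "x * inverse x = 1" if "x \<noteq> 0"
    using that by (simp add: inverse_quat_def mult_qcnj_self of_real_def del: of_real_power)
  show "inverse 0 = (0 :: quat)"
    by (simp add: inverse_quat_def)
  have "(norm (x * y))\<^sup>2 = (norm x * norm y)\<^sup>2"
    unfolding power_mult_distrib norm_quat_sq quat_mult_sel
    by algebra
  then show "norm (x * y) = norm x * norm y"
    by (simp add: power2_eq_iff_nonneg)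
qed (simp add: divide_quat_def)
end

instantiation quat :: euclidean_space
begin
definition Basis_quat_def:
  "Basis = {Quat 1 0 0 0, Quat 0 1 0 0, Quat 0 0 1 0, Quat 0 0 0 1}"
instance
proof
  fix x u v :: quat
  show "(\<forall>u\<in>Basis. inner x u = 0) \<longleftrightarrow> x = 0"
    by (simp add: Basis_quat_def inner_quat_def quat_eq_iff[of x])
  show "inner u v = (if u = v then 1 else 0)" if "u \<in> Basis" "v \<in> Basis"
    using that unfolding Basis_quat_def by (elim insertE emptyE) (simp_all add: inner_quat_def)
qed (simp_all add: Basis_quat_def)
end


section \<open>Right quaternionic Hilbert spaces\<close>

text \<open>
  Real scalars act through their embedding into the quaternions.  Hermitian symmetry makes
  \<open>qinner v v\<close> real, so that its positivity is the positivity of its real part.  The norm and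
  vector-space axioms inherited from \<^class>\<open>real_normed_vector\<close> are consequences of the axioms
  below (the triangle inequality by Cauchy--Schwarz); they are inherited to have the
  topology of the norm at hand.
\<close>

class right_quaternionic_inner = real_normed_vector +
  fixes scaleQ :: "'a \<Rightarrow> quat \<Rightarrow> 'a"  (infixl \<open>*\<^sub>Q\<close> 75)
    and qinner :: "'a \<Rightarrow> 'a \<Rightarrow> quat"
  assumes scaleQ_add_left: "(v + w) *\<^sub>Q p = v *\<^sub>Q p + w *\<^sub>Q p"
    and scaleQ_add_right: "v *\<^sub>Q (p + q) = v *\<^sub>Q p + v *\<^sub>Q q"
    and scaleQ_scaleQ: "(v *\<^sub>Q p) *\<^sub>Q q = v *\<^sub>Q (p * q)"
    and scaleQ_one [simp]: "v *\<^sub>Q 1 = v"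
    and scaleR_scaleQ: "r *\<^sub>R v = v *\<^sub>Q of_real r"
    and qinner_cnj: "qcnj (qinner v w) = qinner w v"
    and qinner_pos: "v \<noteq> 0 \<Longrightarrow> 0 < qRe (qinner v v)"
    and qinner_add_right: "qinner v (u + w) = qinner v u + qinner v w"
    and qinner_scaleQ_right: "qinner v (u *\<^sub>Q q) = qinner v u * q"
    and norm_eq_sqrt_qinner: "norm v = sqrt (qRe (qinner v v))"

class right_quaternionic_hilbert = right_quaternionic_inner + complete_space

definition right_linear ::
  "('a::right_quaternionic_inner \<Rightarrow> 'b::right_quaternionic_inner) \<Rightarrow> bool" where
  "right_linear T \<longleftrightarrow> (\<forall>v w p q. T (v *\<^sub>Q p + w *\<^sub>Q q) = T v *\<^sub>Q p + T w *\<^sub>Q q)"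

definition bounded_right_linear ::
  "('a::right_quaternionic_inner \<Rightarrow> 'b::right_quaternionic_inner) \<Rightarrow> bool" where
  "bounded_right_linear T \<longleftrightarrow> right_linear T \<and> (\<exists>K. \<forall>v. norm (T v) \<le> K * norm v)"


section \<open>The space of square-summable quaternionic families\<close>

text \<open>The nonempty index set is the type \<open>'i\<close>, which may have any cardinality.\<close>

typedef 'i ell2 = "{q :: 'i \<Rightarrow> quat. (\<lambda>i. (norm (q i))\<^sup>2) summable_on UNIV}"
  morphisms ell2_nth Abs_ell2
  by (rule exI[of _ "\<lambda>_. 0"]) simp

lemma ell2_summable: "(\<lambda>i. (norm (ell2_nth q i))\<^sup>2) summable_on UNIV"
  using ell2_nth[of q] by simp

lemma ell2_eqI: "(\<And>i. ell2_nth p i = ell2_nth q i) \<Longrightarrow> p = q"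
  by (metis ell2_nth_inject ext)

lemma ell2_eq_iff: "p = q \<longleftrightarrow> (\<forall>i. ell2_nth p i = ell2_nth q i)"
  by (metis ell2_eqI)

lemma ell2_bdd_summable:
  fixes f :: "'i \<Rightarrow> quat"
  assumes "\<And>F. finite F \<Longrightarrow> (\<Sum>i\<in>F. (norm (f i))\<^sup>2) \<le> C"
  shows "(\<lambda>i. (norm (f i))\<^sup>2) summable_on UNIV"
  by (rule nonneg_bdd_above_summable_on) (auto intro!: bdd_aboveI[of _ C] assms)

lemma ell2_add_summable:
  fixes f g :: "'i \<Rightarrow> quat"
  assumes "(\<lambda>i. (norm (f i))\<^sup>2) summable_on UNIV" "(\<lambda>i. (norm (g i))\<^sup>2) summable_on UNIV"
  shows "(\<lambda>i. (norm (f i + g i))\<^sup>2) summable_on UNIV"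
proof (rule summable_on_comparison_test)
  show "(\<lambda>i. 2 * (norm (f i))\<^sup>2 + 2 * (norm (g i))\<^sup>2) summable_on UNIV"
    using assms by (intro summable_on_add summable_on_cmult_right)
  fix i
  have "(norm (f i + g i))\<^sup>2 \<le> (norm (f i) + norm (g i))\<^sup>2"
    by (intro power_mono norm_triangle_ineq) simp
  also have "\<dots> \<le> 2 * (norm (f i))\<^sup>2 + 2 * (norm (g i))\<^sup>2"
    using sum_squares_ge_zero[of "norm (f i) - norm (g i)" 0]
    by (simp add: power2_eq_square algebra_simps)
  finally show "(norm (f i + g i))\<^sup>2 \<le> 2 * (norm (f i))\<^sup>2 + 2 * (norm (g i))\<^sup>2" .
qed simp

lemma ell2_scale_summable:
  fixes f :: "'i \<Rightarrow> quat"
  assumes "(\<lambda>i. (norm (f i))\<^sup>2) summable_on UNIV"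
  shows "(\<lambda>i. (norm (f i * q))\<^sup>2) summable_on UNIV"
  using summable_on_cmult_left[OF assms, of "(norm q)\<^sup>2"]
  by (simp add: norm_mult power_mult_distrib)

lemma ell2_scaleR_summable:
  fixes f :: "'i \<Rightarrow> quat"
  assumes "(\<lambda>i. (norm (f i))\<^sup>2) summable_on UNIV"
  shows "(\<lambda>i. (norm (r *\<^sub>R f i))\<^sup>2) summable_on UNIV"
  using summable_on_cmult_right[OF assms, of "r\<^sup>2"]
  by (simp add: power_mult_distrib)

lemma ell2_uminus_summable:
  fixes f :: "'i \<Rightarrow> quat"
  assumes "(\<lambda>i. (norm (f i))\<^sup>2) summable_on UNIV"
  shows "(\<lambda>i. (norm (- f i))\<^sup>2) summable_on UNIV"
  using assms by simp

lemma ell2_diff_summable: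
  fixes f g :: "'i \<Rightarrow> quat"
  assumes "(\<lambda>i. (norm (f i))\<^sup>2) summable_on UNIV" "(\<lambda>i. (norm (g i))\<^sup>2) summable_on UNIV"
  shows "(\<lambda>i. (norm (f i - g i))\<^sup>2) summable_on UNIV"
  using ell2_add_summable[OF assms(1), of "\<lambda>i. - g i"] assms(2) by simp

setup_lifting type_definition_ell2

instantiation ell2 :: (type) real_vector
begin
lift_definition zero_ell2 :: "'i ell2" is "\<lambda>_. 0" by simp
lift_definition plus_ell2 :: "'i ell2 \<Rightarrow> 'i ell2 \<Rightarrow> 'i ell2" is "\<lambda>p q i. p i + q i"
  by (rule ell2_add_summable)
lift_definition minus_ell2 :: "'i ell2 \<Rightarrow> 'i ell2 \<Rightarrow> 'i ell2" is "\<lambda>p q i. p i - q i"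
  by (rule ell2_diff_summable)
lift_definition uminus_ell2 :: "'i ell2 \<Rightarrow> 'i ell2" is "\<lambda>q i. - q i"
  by (rule ell2_uminus_summable)
lift_definition scaleR_ell2 :: "real \<Rightarrow> 'i ell2 \<Rightarrow> 'i ell2" is "\<lambda>r q i. r *\<^sub>R q i"
  by (rule ell2_scaleR_summable)
instance
  by standard
    (simp_all add: ell2_eq_iff zero_ell2.rep_eq plus_ell2.rep_eq minus_ell2.rep_eq
      uminus_ell2.rep_eq scaleR_ell2.rep_eq algebra_simps)
end

lemmas ell2_nth_simps [simp] =
  zero_ell2.rep_eq plus_ell2.rep_eq minus_ell2.rep_eq uminus_ell2.rep_eq scaleR_ell2.rep_eq

lemma sqrt_sum_le_ell2:
  assumes "finite F"
  shows "sqrt (\<Sum>i\<in>F. (norm (ell2_nth q i))\<^sup>2) \<le> sqrt (\<Sum>\<^sub>\<infinity>i. (norm (ell2_nth q i))\<^sup>2)"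
  by (intro real_sqrt_le_mono finite_sum_le_infsum ell2_summable assms) auto

instantiation ell2 :: (type) real_normed_vector
begin
definition norm_ell2_def: "norm q = sqrt (\<Sum>\<^sub>\<infinity>i. (norm (ell2_nth q i))\<^sup>2)"
definition dist_ell2_def: "dist p q = norm (p - q :: 'a ell2)"
definition sgn_ell2_def: "sgn q = (q :: 'a ell2) /\<^sub>R norm q"
definition uniformity_ell2_def [code del]:
  "(uniformity :: ('a ell2 \<times> 'a ell2) filter) = (INF e\<in>{0 <..}. principal {(x, y). dist x y < e})"
definition open_ell2_def [code del]:
  "open (U :: 'a ell2 set) \<longleftrightarrow> (\<forall>x\<in>U. eventually (\<lambda>(x', y). x' = x \<longrightarrow> y \<in> U) uniformity)"
instance
proof
  fix x y :: "'a ell2" and r :: real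
  show "(norm x = 0) = (x = 0)"
  proof
    assume "norm x = 0"
    then have 0: "(\<Sum>\<^sub>\<infinity>i. (norm (ell2_nth x i))\<^sup>2) = 0"
      by (simp add: norm_ell2_def)
    have "(norm (ell2_nth x i))\<^sup>2 = 0" for i
      by (rule nonneg_infsum_le_0D[where A = UNIV]) (use 0 ell2_summable[of x] in auto)
    then show "x = 0"
      by (intro ell2_eqI) simp
  qed (simp add: norm_ell2_def)
  show "norm (r *\<^sub>R x) = \<bar>r\<bar> * norm x"
    by (simp add: norm_ell2_def power_mult_distrib infsum_cmult_right' real_sqrt_mult)
  have nn: "norm z \<ge> 0" for z :: "'a ell2"
    by (simp add: norm_ell2_def infsum_nonneg)
  have "(\<Sum>\<^sub>\<infinity>i. (norm (ell2_nth (x + y) i))\<^sup>2) \<le> (norm x + norm y)\<^sup>2"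
  proof (rule infsum_le_finite_sums[OF ell2_summable])
    fix F :: "'a set" assume F: "finite F"
    have "sqrt (\<Sum>i\<in>F. (norm (ell2_nth (x + y) i))\<^sup>2)
        \<le> L2_set (\<lambda>i. norm (ell2_nth x i) + norm (ell2_nth y i)) F"
      unfolding L2_set_def
      by (intro real_sqrt_le_mono sum_mono power_mono) (auto intro: norm_triangle_ineq)
    also have "\<dots> \<le> L2_set (\<lambda>i. norm (ell2_nth x i)) F + L2_set (\<lambda>i. norm (ell2_nth y i)) F"
      by (rule L2_set_triangle_ineq)
    also have "\<dots> \<le> norm x + norm y"
      unfolding L2_set_def norm_ell2_def by (intro add_mono sqrt_sum_le_ell2 F)
    finally show "(\<Sum>i\<in>F. (norm (ell2_nth (x + y) i))\<^sup>2) \<le> (norm x + norm y)\<^sup>2"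
      by (rule sqrt_le_D)
  qed
  then show "norm (x + y) \<le> norm x + norm y"
    unfolding norm_ell2_def[of "x + y"] by (intro real_le_lsqrt add_nonneg_nonneg nn)
qed (simp_all add: dist_ell2_def sgn_ell2_def uniformity_ell2_def open_ell2_def)
end

lemma norm_ell2_sq: "(norm q)\<^sup>2 = (\<Sum>\<^sub>\<infinity>i. (norm (ell2_nth q i))\<^sup>2)"
  by (simp add: norm_ell2_def infsum_nonneg)

lemma finite_sum_le_norm_ell2:
  "finite F \<Longrightarrow> (\<Sum>i\<in>F. (norm (ell2_nth q i))\<^sup>2) \<le> (norm q)\<^sup>2"
  unfolding norm_ell2_sq by (rule finite_sum_le_infsum[OF ell2_summable]) auto

lemma norm_ell2_nth_le: "norm (ell2_nth q i) \<le> norm q"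
  using finite_sum_le_norm_ell2[of "{i}" q] by (simp add: power2_le_iff_abs_le)

lemma qcnj_mult_summable:
  "(\<lambda>i. qcnj (ell2_nth p i) * ell2_nth q i) summable_on UNIV"
proof (rule abs_summable_summable, rule summable_on_comparison_test)
  show "(\<lambda>i. (norm (ell2_nth p i))\<^sup>2 + (norm (ell2_nth q i))\<^sup>2) summable_on UNIV"
    by (intro summable_on_add ell2_summable)
  fix i
  have "2 * norm (ell2_nth p i) * norm (ell2_nth q i)
      \<le> (norm (ell2_nth p i))\<^sup>2 + (norm (ell2_nth q i))\<^sup>2"
    by (rule sum_squares_bound)
  moreover have "0 \<le> norm (ell2_nth p i) * norm (ell2_nth q i)"
    by simp
  ultimately have "norm (ell2_nth p i) * norm (ell2_nth q i)
      \<le> (norm (ell2_nth p i))\<^sup>2 + (norm (ell2_nth q i))\<^sup>2"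
    by linarith
  then show "norm (qcnj (ell2_nth p i) * ell2_nth q i)
      \<le> (norm (ell2_nth p i))\<^sup>2 + (norm (ell2_nth q i))\<^sup>2"
    by (simp add: norm_mult)
qed simp

lemma bounded_linear_qRe: "bounded_linear qRe"
proof (rule bounded_linear_intro[where K = 1])
  fix x :: quat
  have "(qRe x)\<^sup>2 \<le> (norm x)\<^sup>2"
    by (simp add: norm_quat_sq)
  then show "norm (qRe x) \<le> norm x * 1"
    using abs_le_square_iff[of "qRe x" "norm x"] by simp
qed simp_all

lemma bounded_linear_qcnj: "bounded_linear qcnj"
  by (rule bounded_linear_intro[where K = 1]) (simp_all add: quat_eq_iff)

instantiation ell2 :: (type) right_quaternionic_inner
begin
lift_definition scaleQ_ell2 :: "'i ell2 \<Rightarrow> quat \<Rightarrow> 'i ell2" is "\<lambda>p q i. p i * q"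
  by (rule ell2_scale_summable)
definition qinner_ell2 :: "'a ell2 \<Rightarrow> 'a ell2 \<Rightarrow> quat" where
  "qinner p q = (\<Sum>\<^sub>\<infinity>i. qcnj (ell2_nth p i) * ell2_nth q i)"
instance
proof
  fix u v w :: "'a ell2" and p q :: quat and r :: real
  show "(v + w) *\<^sub>Q p = v *\<^sub>Q p + w *\<^sub>Q p"
    "v *\<^sub>Q (p + q) = v *\<^sub>Q p + v *\<^sub>Q q"
    "(v *\<^sub>Q p) *\<^sub>Q q = v *\<^sub>Q (p * q)"
    "v *\<^sub>Q 1 = v"
    by (transfer; simp add: algebra_simps)+
  show "r *\<^sub>R v = v *\<^sub>Q of_real r"
    by transfer (simp add: of_real_def)
  show "qcnj (qinner v w) = qinner w v"
    unfolding qinner_ell2_def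
    using has_sum_bounded_linear[OF bounded_linear_qcnj has_sum_infsum[OF qcnj_mult_summable], of v w]
    by (simp add: o_def qcnj_mult infsumI)
  show "qinner v (u + w) = qinner v u + qinner v w"
    unfolding qinner_ell2_def
    by (simp add: distrib_left infsum_add qcnj_mult_summable)
  show "qinner v (u *\<^sub>Q q) = qinner v u * q"
    unfolding qinner_ell2_def
    by (simp add: scaleQ_ell2.rep_eq mult.assoc[symmetric] infsum_cmult_left')
  have Re: "qRe (qinner z z) = (norm z)\<^sup>2" for z :: "'a ell2"
    unfolding qinner_ell2_def norm_ell2_sq
    using has_sum_bounded_linear[OF bounded_linear_qRe has_sum_infsum[OF qcnj_mult_summable], of z z]
    by (simp add: o_def qcnj_mult_self infsumI del: of_real_power)
  show "0 < qRe (qinner v v)" if "v \<noteq> 0"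
    using that by (simp add: Re)
  show "norm v = sqrt (qRe (qinner v v))"
    by (simp add: Re)
qed
end

instance ell2 :: (type) right_quaternionic_hilbert
proof
  fix X :: "nat \<Rightarrow> 'a ell2"
  assume X: "Cauchy X"
  have "convergent (\<lambda>n. ell2_nth (X n) i)" for i
  proof (rule Cauchy_convergent, rule metric_CauchyI)
    fix e :: real assume "e > 0"
    then obtain M where "\<forall>m\<ge>M. \<forall>n\<ge>M. dist (X m) (X n) < e"
      using metric_CauchyD[OF X] by blast
    moreover have "dist (ell2_nth (X m) i) (ell2_nth (X n) i) \<le> dist (X m) (X n)" for m n
      using norm_ell2_nth_le[of "X m - X n" i] by (simp add: dist_norm)
    ultimately show "\<exists>M. \<forall>m\<ge>M. \<forall>n\<ge>M. dist (ell2_nth (X m) i) (ell2_nth (X n) i) < e"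
      using le_less_trans by blast
  qed
  then have "\<forall>i. \<exists>a. (\<lambda>n. ell2_nth (X n) i) \<longlonglongrightarrow> a"
    unfolding convergent_def by blast
  from choice[OF this] obtain l where l: "\<And>i. (\<lambda>n. ell2_nth (X n) i) \<longlonglongrightarrow> l i"
    by blast
  have bound: "(\<Sum>i\<in>F. (norm (ell2_nth (X m) i - l i))\<^sup>2) \<le> e\<^sup>2"
    if "finite F" "\<forall>n\<ge>M. dist (X m) (X n) < e" for F m M e
  proof (rule Lim_bounded)
    show "(\<lambda>n. \<Sum>i\<in>F. (norm (ell2_nth (X m) i - ell2_nth (X n) i))\<^sup>2)
        \<longlonglongrightarrow> (\<Sum>i\<in>F. (norm (ell2_nth (X m) i - l i))\<^sup>2)"
      by (intro tendsto_intros l)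
    show "\<forall>n\<ge>M. (\<Sum>i\<in>F. (norm (ell2_nth (X m) i - ell2_nth (X n) i))\<^sup>2) \<le> e\<^sup>2"
    proof (intro allI impI)
      fix n assume "n \<ge> M"
      then have "norm (X m - X n) \<le> e"
        using that(2) by (simp add: dist_norm less_imp_le)
      then have "(norm (X m - X n))\<^sup>2 \<le> e\<^sup>2"
        by (intro power_mono) auto
      then show "(\<Sum>i\<in>F. (norm (ell2_nth (X m) i - ell2_nth (X n) i))\<^sup>2) \<le> e\<^sup>2"
        using finite_sum_le_norm_ell2[OF that(1), of "X m - X n"] by simp
    qed
  qed
  obtain M1 where M1: "\<forall>m\<ge>M1. \<forall>n\<ge>M1. dist (X m) (X n) < 1"
    using metric_CauchyD[OF X zero_less_one] by blast
  have "(\<lambda>i. (norm (ell2_nth (X M1) i - l i))\<^sup>2) summable_on UNIV"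
  proof (rule ell2_bdd_summable)
    fix F :: "'a set" assume "finite F"
    then show "(\<Sum>i\<in>F. (norm (ell2_nth (X M1) i - l i))\<^sup>2) \<le> 1\<^sup>2"
      by (rule bound) (use M1 in blast)
  qed
  from ell2_diff_summable[OF ell2_summable[of "X M1"] this]
  have "(\<lambda>i. (norm (l i))\<^sup>2) summable_on UNIV"
    by simp
  then have L: "ell2_nth (Abs_ell2 l) = l"
    by (simp add: Abs_ell2_inverse)
  have "X \<longlonglongrightarrow> Abs_ell2 l"
  proof (rule metric_LIMSEQ_I)
    fix e :: real assume e: "e > 0"
    then obtain M where M: "\<forall>m\<ge>M. \<forall>n\<ge>M. dist (X m) (X n) < e / 2"
      using metric_CauchyD[OF X, of "e / 2"] by auto
    have "dist (X m) (Abs_ell2 l) < e" if "m \<ge> M" for m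
    proof -
      have "(\<Sum>\<^sub>\<infinity>i. (norm (ell2_nth (X m - Abs_ell2 l) i))\<^sup>2) \<le> (e / 2)\<^sup>2"
      proof (rule infsum_le_finite_sums[OF ell2_summable])
        fix F :: "'a set" assume "finite F"
        then show "(\<Sum>i\<in>F. (norm (ell2_nth (X m - Abs_ell2 l) i))\<^sup>2) \<le> (e / 2)\<^sup>2"
          unfolding minus_ell2.rep_eq L by (rule bound) (use M that in blast)
      qed
      then have "(norm (X m - Abs_ell2 l))\<^sup>2 \<le> (e / 2)\<^sup>2"
        by (simp only: norm_ell2_sq)
      then have "norm (X m - Abs_ell2 l) \<le> e / 2"
        by (rule power2_le_imp_le) (use e in simp)
      then show ?thesis
        using e by (simp add: dist_norm)
    qed
    then show "\<exists>M. \<forall>m\<ge>M. dist (X m) (Abs_ell2 l) < e"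
      by blast
  qed
  then show "convergent X"
    by (rule convergentI)
qed


section \<open>Frames and the synthesis operator\<close>

text \<open>
  The sum is taken in \<^typ>\<open>ennreal\<close>, where it is the supremum of the finite partial sums and
  hence possibly infinite; a real-valued \<^const>\<open>infsum\<close> would be 0 for a divergent sum.
\<close>

definition is_frame :: "('i \<Rightarrow> 'v::right_quaternionic_hilbert) \<Rightarrow> bool" where
  "is_frame u \<longleftrightarrow> (\<exists>A B :: real. 0 < A \<and> A \<le> B \<and>
     (\<forall>v. ennreal (A * (norm v)\<^sup>2) \<le> (\<Sum>\<^sub>\<infinity>i. ennreal ((norm (qinner (u i) v))\<^sup>2)) \<and>
          (\<Sum>\<^sub>\<infinity>i. ennreal ((norm (qinner (u i) v))\<^sup>2)) \<le> ennreal (B * (norm v)\<^sup>2)))"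

definition synthesis_well_defined :: "('i \<Rightarrow> 'v::right_quaternionic_hilbert) \<Rightarrow> bool" where
  "synthesis_well_defined u \<longleftrightarrow>
     (\<forall>q :: 'i ell2. (\<lambda>i. u i *\<^sub>Q ell2_nth q i) summable_on UNIV)"

definition synthesis :: "('i \<Rightarrow> 'v::right_quaternionic_hilbert) \<Rightarrow> 'i ell2 \<Rightarrow> 'v" where
  "synthesis u q = (\<Sum>\<^sub>\<infinity>i. u i *\<^sub>Q ell2_nth q i)"

end

(* Writing T for the synthesis operator and T* v = (<u_i|v>)_i for the analysis operator, the frame
   inequalities say that T* maps V into l_2, is bounded, and is bounded below.  The upper bound is
   equivalent to boundedness of T by duality.  If T* is bounded below, T T* is coercive, hence onto
   by a contraction argument; if T is onto, the uniform boundedness principle bounds T* below. *)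

theory Submission
  imports Defs
begin

section \<open>Quaternionic inner products\<close>

lemma qcnj_diff: "qcnj (p - q) = qcnj p - qcnj q"
  by (simp add: quat_eq_iff)

lemma of_real_commute_quat: "of_real r * q = q * of_real r" for q :: quat
  by (simp add: of_real_def)

lemma qinner_scaleQ_left: "qinner (u *\<^sub>Q q) v = qcnj q * qinner u v"
  for u v :: "'v::right_quaternionic_inner"
  using qinner_cnj[of v "u *\<^sub>Q q"] by (simp add: qinner_scaleQ_right qcnj_mult qinner_cnj)

lemma qinner_zero_right [simp]: "qinner v 0 = 0"
  for v :: "'v::right_quaternionic_inner"
  using qinner_add_right[of v 0 0] by simp

lemma qinner_diff_right: "qinner v (u - w) = qinner v u - qinner v w"
  for u v w :: "'v::right_quaternionic_inner"
  using qinner_add_right[of v "u - w" w] by (simp add: algebra_simps)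

lemma qinner_diff_left: "qinner (u - w) v = qinner u v - qinner w v"
  for u v w :: "'v::right_quaternionic_inner"
  using qinner_cnj[of v "u - w"] by (simp add: qinner_diff_right qcnj_diff qinner_cnj)

lemma qinner_scaleR_right: "qinner v (r *\<^sub>R u) = r *\<^sub>R qinner v u"
  for u v :: "'v::right_quaternionic_inner"
  by (simp add: scaleR_scaleQ qinner_scaleQ_right of_real_def)

lemma norm_qinner_commute: "norm (qinner v w) = norm (qinner w v)"
  for v w :: "'v::right_quaternionic_inner"
  by (metis norm_qcnj qinner_cnj)

lemma qinner_self: "qinner v v = of_real ((norm v)\<^sup>2)"
  for v :: "'v::right_quaternionic_inner"
proof -
  have "qRe (qinner v v) \<ge> 0"
    using qinner_pos[of v] by (cases "v = 0") auto
  then have "(norm v)\<^sup>2 = qRe (qinner v v)"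
    by (simp add: norm_eq_sqrt_qinner)
  then show ?thesis
    using qinner_cnj[of v v] by (simp add: quat_eq_iff del: of_real_power)
qed

lemma norm_sq_eq_norm_qinner: "(norm v)\<^sup>2 = norm (qinner v v)"
  for v :: "'v::right_quaternionic_inner"
  unfolding qinner_self norm_of_real by simp

text \<open>The two cross terms are conjugate and so share their real part. This expansion drives
  both Cauchy-Schwarz and the contraction estimate for the frame operator.\<close>

lemma norm_diff_sq_qinner:
  "(norm (v - w))\<^sup>2 = (norm v)\<^sup>2 - 2 * qRe (qinner v w) + (norm w)\<^sup>2"
  for v w :: "'v::right_quaternionic_inner"
proof -
  have "(norm x)\<^sup>2 = qRe (qinner x x)" for x :: 'v
    unfolding qinner_self by (simp del: of_real_power)
  moreover have "qRe (qinner w v) = qRe (qinner v w)"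
    by (metis qinner_cnj qcnj_sel(1))
  ultimately show ?thesis
    by (simp add: qinner_diff_left qinner_diff_right)
qed

lemma norm_scaleQ: "norm (v *\<^sub>Q q) = norm v * norm q"
  for v :: "'v::right_quaternionic_inner"
proof -
  have "qinner (v *\<^sub>Q q) (v *\<^sub>Q q) = qcnj q * (of_real ((norm v)\<^sup>2) * q)"
    by (simp only: qinner_scaleQ_right qinner_scaleQ_left qinner_self[of v] mult.assoc)
  then have "(norm (v *\<^sub>Q q))\<^sup>2 = (norm v * norm q)\<^sup>2"
    unfolding norm_sq_eq_norm_qinner[of "v *\<^sub>Q q"]
    by (simp add: norm_mult norm_power power2_eq_square)
  then show ?thesis
    by simp
qed

text \<open>Cauchy-Schwarz: \<open>w *\<^sub>Q ((1 / N) *\<^sub>R c)\<close> is the orthogonal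
  projection of \<open>v\<close> onto the right span of \<open>w\<close>, and the squared distance
  from \<open>v\<close> to it is nonnegative.\<close>

lemma norm_qinner_le: "norm (qinner v w) \<le> norm v * norm w"
  for v w :: "'v::right_quaternionic_inner"
proof (cases "w = 0")
  case False
  define N where "N = (norm w)\<^sup>2"
  define c where "c = qinner w v"
  have N: "N > 0"
    using False by (simp add: N_def)
  have c': "qinner v w = qcnj c"
    by (simp add: c_def qinner_cnj)
  have "qinner v (w *\<^sub>Q ((1 / N) *\<^sub>R c)) = (1 / N) *\<^sub>R of_real ((norm c)\<^sup>2)"
    by (simp add: qinner_scaleQ_right c' qcnj_mult_self del: of_real_power)
  then have "0 \<le> (norm v)\<^sup>2 - 2 * ((norm c)\<^sup>2 / N) + (norm (w *\<^sub>Q ((1 / N) *\<^sub>R c)))\<^sup>2"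
    using norm_diff_sq_qinner[of v "w *\<^sub>Q ((1 / N) *\<^sub>R c)"]
      zero_le_power2[of "norm (v - w *\<^sub>Q ((1 / N) *\<^sub>R c))"]
    by (simp del: of_real_power)
  moreover have "(norm (w *\<^sub>Q ((1 / N) *\<^sub>R c)))\<^sup>2 = (norm c)\<^sup>2 / N"
    using N by (simp add: norm_scaleQ power_mult_distrib power_divide flip: N_def)
      (simp add: power2_eq_square)
  ultimately have "(norm c)\<^sup>2 / N \<le> (norm v)\<^sup>2"
    by linarith
  then have "(norm c)\<^sup>2 \<le> (norm v * norm w)\<^sup>2"
    using N by (simp add: field_simps power_mult_distrib N_def)
  then have "norm c \<le> norm v * norm w"
    by (rule power2_le_imp_le) simp
  then show ?thesis
    by (simp add: c')
qed simp

lemma scaleQ_zero_right [simp]: "v *\<^sub>Q 0 = 0"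
  for v :: "'v::right_quaternionic_inner"
  using norm_scaleQ[of v 0] by simp

lemma bounded_linear_qinner_right: "bounded_linear (qinner v)"
  for v :: "'v::right_quaternionic_inner"
  by (rule bounded_linear_intro[where K = "norm v"])
    (simp_all add: qinner_add_right qinner_scaleR_right norm_qinner_le[of v] mult.commute[of _ "norm v"])

lemma bounded_linear_scaleQ_left: "bounded_linear (\<lambda>v :: 'v::right_quaternionic_inner. v *\<^sub>Q q)"
  by (rule bounded_linear_intro[where K = "norm q"])
    (simp_all add: scaleQ_add_left norm_scaleQ scaleR_scaleQ scaleQ_scaleQ of_real_commute_quat)


section \<open>Bessel families\<close>

text \<open>The bound applied to a difference \<open>F - F0\<close> shows that the net of partial
  sums of \<open>f\<close> is Cauchy because that of \<open>g\<close> converges; completeness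
  supplies the limit.\<close>

lemma summable_on_sq_dominated:
  fixes f :: "'i \<Rightarrow> 'v::{real_normed_vector, complete_space}" and g :: "'i \<Rightarrow> real"
  assumes g: "g summable_on A"
    and bound: "\<And>F. finite F \<Longrightarrow> F \<subseteq> A \<Longrightarrow> (norm (sum f F))\<^sup>2 \<le> B * sum g F"
    and B: "0 \<le> B"
  shows "f summable_on A"
proof -
  have "cauchy_filter (filtermap (sum f) (finite_subsets_at_top A))"
    unfolding cauchy_filter_metric_filtermap
  proof (intro allI impI)
    fix e :: real
    assume e: "0 < e"
    \<comment> \<open>Tails of \<open>g\<close> beyond \<open>F0\<close> stay below
      \<open>2 * d\<close>, so \<open>B * (2 * d)\<close> must be less than
      \<open>(e / 2)\<^sup>2\<close>; the summand 1 keeps the denominator positive when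
      \<open>B = 0\<close>.\<close>
    define d where "d = (e / 2)\<^sup>2 / (2 * (B + 1))"
    have d: "d > 0"
      using e B by (simp add: d_def)
    have "\<forall>\<^sub>F F in finite_subsets_at_top A. dist (sum g F) (infsum g A) < d"
      using has_sum_infsum[OF g] d unfolding has_sum_def by (rule tendstoD)
    then obtain F0 where F0: "finite F0" "F0 \<subseteq> A"
      and close: "\<And>F. finite F \<Longrightarrow> F0 \<subseteq> F \<Longrightarrow> F \<subseteq> A \<Longrightarrow> dist (sum g F) (infsum g A) < d"
      unfolding eventually_finite_subsets_at_top by metis
    have near: "dist (sum f F) (sum f F0) < e / 2" if F: "finite F" "F0 \<subseteq> F" "F \<subseteq> A" for F
    proof -
      have "sum g (F - F0) = sum g F - sum g F0"
        using F by (simp add: sum_diff)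
      also have "\<dots> < 2 * d"
        using close[OF F] close[OF F0(1) order_refl F0(2)] by (simp add: dist_real_def)
      finally have "B * sum g (F - F0) \<le> B * (2 * d)"
        using B by (intro mult_left_mono) auto
      also have "\<dots> < (e / 2)\<^sup>2"
        using B e by (simp add: d_def field_simps)
      finally have "(norm (sum f (F - F0)))\<^sup>2 < (e / 2)\<^sup>2"
        using F by (intro le_less_trans[OF bound]) auto
      then have "norm (sum f (F - F0)) < e / 2"
        by (rule power2_less_imp_less) (use e in simp)
      then show ?thesis
        using F by (simp add: dist_norm sum_diff)
    qed
    have "dist (sum f F) (sum f F') < e"
      if "finite F \<and> F0 \<subseteq> F \<and> F \<subseteq> A" "finite F' \<and> F0 \<subseteq> F' \<and> F' \<subseteq> A" for F F'
      using near[of F] near[of F'] that by (meson dist_triangle_half_l)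
    then show "\<exists>P. eventually P (finite_subsets_at_top A) \<and>
        (\<forall>F F'. P F \<and> P F' \<longrightarrow> dist (sum f F) (sum f F') < e)"
      using F0 by (intro exI[of _ "\<lambda>F. finite F \<and> F0 \<subseteq> F \<and> F \<subseteq> A"])
        (auto simp: eventually_finite_subsets_at_top)
  qed
  then obtain L where "(sum f \<longlongrightarrow> L) (finite_subsets_at_top A)"
    using complete_uniform[where S = UNIV] complete_UNIV
    by (force simp add: filterlim_def)
  then show ?thesis
    using summable_on_def has_sum_def by blast
qed

section \<open>The adjoint pair of analysis and synthesis operators\<close>

text \<open>\<open>Abs_ell2\<close> is meaningful only on square-summable families, so the
  coefficients can be read off only under a Bessel bound.\<close>

definition analysis :: "('i \<Rightarrow> 'v::right_quaternionic_hilbert) \<Rightarrow> 'v \<Rightarrow> 'i ell2" where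
  "analysis u v = Abs_ell2 (\<lambda>i. qinner (u i) v)"

text \<open>The upper frame inequality is put in terms of finite real sums, so that it can be stated
  before any summability is known.\<close>

locale bessel_family =
  fixes u :: "'i \<Rightarrow> 'v::right_quaternionic_hilbert" and B :: real
  assumes bound_nonneg: "0 \<le> B"
    and bessel: "finite F \<Longrightarrow> (\<Sum>i\<in>F. (norm (qinner (u i) v))\<^sup>2) \<le> B * (norm v)\<^sup>2"
begin

lemma analysis_summable: "(\<lambda>i. (norm (qinner (u i) v))\<^sup>2) summable_on UNIV"
  by (rule ell2_bdd_summable) (rule bessel)

lemma analysis_nth [simp]: "ell2_nth (analysis u v) i = qinner (u i) v"
  by (simp add: analysis_def Abs_ell2_inverse analysis_summable)

lemma norm_analysis_sq: "(norm (analysis u v))\<^sup>2 = (\<Sum>\<^sub>\<infinity>i. (norm (qinner (u i) v))\<^sup>2)"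
  by (simp add: norm_ell2_sq)

lemma norm_analysis_sq_le: "(norm (analysis u v))\<^sup>2 \<le> B * (norm v)\<^sup>2"
  unfolding norm_analysis_sq by (rule infsum_le_finite_sums[OF analysis_summable]) (rule bessel)

lemma analysis_diff: "analysis u (v - w) = analysis u v - analysis u w"
  by (rule ell2_eqI) (simp add: qinner_diff_right)

text \<open>Duality: the sum \<open>w\<close> is paired with itself, the finite Cauchy-Schwarz
  inequality and the Bessel bound at \<open>w\<close> are applied, and one factor
  \<open>norm w\<close> is cancelled.\<close>

lemma norm_sum_sq_le:
  assumes F: "finite F"
  shows "(norm (\<Sum>i\<in>F. u i *\<^sub>Q q i))\<^sup>2 \<le> B * (\<Sum>i\<in>F. (norm (q i))\<^sup>2)"
proof -
  define w where "w = (\<Sum>i\<in>F. u i *\<^sub>Q q i)"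
  have "qinner w w = (\<Sum>i\<in>F. qinner w (u i) * q i)"
    unfolding w_def[symmetric] using bounded_linear.linear[OF bounded_linear_qinner_right[of w]]
    by (subst (2) w_def) (simp add: linear_sum qinner_scaleQ_right)
  then have "(norm w)\<^sup>2 \<le> (\<Sum>i\<in>F. norm (qinner w (u i) * q i))"
    unfolding norm_sq_eq_norm_qinner by (simp add: norm_sum)
  also have "\<dots> = (\<Sum>i\<in>F. \<bar>norm (qinner (u i) w)\<bar> * \<bar>norm (q i)\<bar>)"
    by (simp add: norm_mult norm_qinner_commute[of w])
  also have "\<dots> \<le> L2_set (\<lambda>i. norm (qinner (u i) w)) F * L2_set (\<lambda>i. norm (q i)) F"
    by (rule L2_set_mult_ineq)
  also have "\<dots> \<le> (sqrt B * norm w) * sqrt (\<Sum>i\<in>F. (norm (q i))\<^sup>2)"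
  proof (rule mult_mono)
    show "L2_set (\<lambda>i. norm (qinner (u i) w)) F \<le> sqrt B * norm w"
      using real_sqrt_le_mono[OF bessel[OF F, of w]]
      by (simp add: L2_set_def real_sqrt_mult)
  qed (use bound_nonneg in \<open>simp_all add: L2_set_def sum_nonneg\<close>)
  finally have "norm w \<le> sqrt B * sqrt (\<Sum>i\<in>F. (norm (q i))\<^sup>2)"
    using bound_nonneg by (cases "w = 0") (auto simp: power2_eq_square sum_nonneg)
  then have "(norm w)\<^sup>2 \<le> (sqrt B * sqrt (\<Sum>i\<in>F. (norm (q i))\<^sup>2))\<^sup>2"
    by (intro power_mono) auto
  then show ?thesis
    using bound_nonneg by (simp add: w_def power_mult_distrib sum_nonneg)
qed

lemma synthesis_summable: "(\<lambda>i. u i *\<^sub>Q ell2_nth q i) summable_on UNIV"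
  by (rule summable_on_sq_dominated[OF ell2_summable[of q]])
    (use norm_sum_sq_le bound_nonneg in auto)

text \<open>Adjointness of the two operators: the inner product is continuous and hence passes
  through the series.\<close>

lemma qinner_synthesis: "qinner v (synthesis u q) = qinner (analysis u v) q"
proof -
  have "((\<lambda>i. qinner v (u i *\<^sub>Q ell2_nth q i)) has_sum qinner v (synthesis u q)) UNIV"
    unfolding synthesis_def
    by (intro has_sum_bounded_linear[OF bounded_linear_qinner_right] has_sum_infsum
          synthesis_summable)
  then show ?thesis
    by (simp add: qinner_ell2_def qinner_scaleQ_right qinner_cnj infsumI)
qed

text \<open>Adjointness at the vector \<open>synthesis u q\<close> itself, with Cauchy-Schwarz,
  transfers the bound of the analysis operator; one factor of the norm cancels.\<close>

lemma norm_synthesis_sq_le: "(norm (synthesis u q))\<^sup>2 \<le> B * (norm q)\<^sup>2"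
proof -
  let ?w = "synthesis u q"
  have "(norm ?w)\<^sup>2 \<le> norm (analysis u ?w) * norm q"
    unfolding norm_sq_eq_norm_qinner[of ?w] qinner_synthesis by (rule norm_qinner_le)
  also have "\<dots> \<le> (sqrt B * norm ?w) * norm q"
    using real_sqrt_le_mono[OF norm_analysis_sq_le[of ?w]]
    by (intro mult_right_mono) (simp_all add: real_sqrt_mult)
  finally have "norm ?w \<le> sqrt B * norm q"
    using bound_nonneg by (cases "?w = 0") (auto simp: power2_eq_square)
  then have "(norm ?w)\<^sup>2 \<le> (sqrt B * norm q)\<^sup>2"
    by (intro power_mono) auto
  then show ?thesis
    using bound_nonneg by (simp add: power_mult_distrib)
qed

lemma right_linear_synthesis: "right_linear (synthesis u)"
proof -
  have scale: "((\<lambda>i. u i *\<^sub>Q ell2_nth (v *\<^sub>Q p) i) has_sum synthesis u v *\<^sub>Q p) UNIV" for v p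
    using has_sum_bounded_linear[OF bounded_linear_scaleQ_left
        has_sum_infsum[OF synthesis_summable[of v]], of p]
    by (simp add: synthesis_def scaleQ_ell2.rep_eq scaleQ_scaleQ)
  have "synthesis u (v *\<^sub>Q p + w *\<^sub>Q q) = synthesis u v *\<^sub>Q p + synthesis u w *\<^sub>Q q" for v w p q
    using infsumI[OF has_sum_add[OF scale[of v p] scale[of w q]]]
    by (simp add: synthesis_def scaleQ_add_right)
  then show ?thesis
    by (simp add: right_linear_def)
qed

lemma bounded_right_linear_synthesis: "bounded_right_linear (synthesis u)"
proof -
  have "norm (synthesis u q) \<le> sqrt B * norm q" for q
    using real_sqrt_le_mono[OF norm_synthesis_sq_le[of q]] by (simp add: real_sqrt_mult)
  then show ?thesis
    unfolding bounded_right_linear_def using right_linear_synthesis by blast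
qed

lemma synthesis_diff: "synthesis u (p - q) = synthesis u p - synthesis u q"
proof -
  \<comment> \<open>Right linearity speaks of two-term combinations only, so the difference is
    written with coefficients 1 and -1.\<close>
  have "p - q = p *\<^sub>Q 1 + q *\<^sub>Q of_real (- 1)"
    by (simp flip: scaleR_scaleQ del: of_real_minus of_real_1)
  then have "synthesis u (p - q) = synthesis u p *\<^sub>Q 1 + synthesis u q *\<^sub>Q of_real (- 1)"
    using right_linear_synthesis unfolding right_linear_def by metis
  then show ?thesis
    by (simp flip: scaleR_scaleQ del: of_real_minus of_real_1)
qed

section \<open>Surjectivity of synthesis versus the lower frame bound\<close>

text \<open>With the frame operator \<open>S\<close> (synthesis after analysis), the map \<open>v \<mapsto> v - S v / B + w / B\<close>
  is a contraction, and its fixed point solves \<open>S v = w\<close>.\<close>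

lemma surj_synthesis:
  assumes A: "0 < A" and AB: "A \<le> B"
    and lower: "\<And>v. A * (norm v)\<^sup>2 \<le> (norm (analysis u v))\<^sup>2"
  shows "surj (synthesis u)"
proof -
  have B: "0 < B"
    using A AB by simp
  define S where "S v = synthesis u (analysis u v)" for v
  define c where "c = sqrt (1 - A / B)"
  have c: "0 \<le> c" "c < 1"
    using A AB B by (auto simp: c_def)
  have contract: "norm (v - (1 / B) *\<^sub>R S v) \<le> c * norm v" for v
  proof -
    have q: "qRe (qinner v ((1 / B) *\<^sub>R S v)) = (norm (analysis u v))\<^sup>2 / B"
      unfolding S_def by (simp add: qinner_scaleR_right qinner_synthesis qinner_self del: of_real_power)
    \<comment> \<open>The quadratic term of the expansion cancels one of the two copies of the cross
      term; the remaining copy is bounded below by \<open>lower\<close>, which leaves the factor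
      \<open>1 - A / B\<close>.\<close>
    have "(norm ((1 / B) *\<^sub>R S v))\<^sup>2 \<le> (norm (analysis u v))\<^sup>2 / B"
      using norm_synthesis_sq_le[of "analysis u v"] B
      by (simp add: S_def power_divide power2_eq_square[of B] field_simps)
    moreover have "A / B * (norm v)\<^sup>2 \<le> (norm (analysis u v))\<^sup>2 / B"
      using lower[of v] B by (simp add: field_simps)
    ultimately have "(norm (v - (1 / B) *\<^sub>R S v))\<^sup>2 \<le> (1 - A / B) * (norm v)\<^sup>2"
      unfolding norm_diff_sq_qinner q by (simp add: left_diff_distrib)
    also have "\<dots> = (c * norm v)\<^sup>2"
      using AB B by (simp add: c_def power_mult_distrib)
    finally show ?thesis
      by (rule power2_le_imp_le) (use c in simp)
  qed
  have "\<exists>v. S v = w" for w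
  proof -
    define f where "f v = v - (1 / B) *\<^sub>R S v + (1 / B) *\<^sub>R w" for v
    have "dist (f v) (f v') \<le> c * dist v v'" for v v'
    proof -
      have "f v - f v' = (v - v') - (1 / B) *\<^sub>R S (v - v')"
        by (simp add: f_def S_def analysis_diff synthesis_diff algebra_simps)
      then show ?thesis
        using contract[of "v - v'"] by (simp add: dist_norm)
    qed
    then obtain v where "f v = v"
      using banach_fix_type[of c f] c by blast
    then have "S v = w"
      using B by (auto simp: f_def algebra_simps)
    then show ?thesis ..
  qed
  then show ?thesis
    unfolding S_def surj_def by metis
qed

text \<open>Every \<open>w = synthesis u q\<close> satisfies \<open>norm (qinner w v) \<le> norm q * norm (analysis u v)\<close>,
  so surjectivity writes the space as a countable union of closed sets to which Baire's theorem
  applies.\<close>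

lemma analysis_bounded_below:
  assumes surj: "surj (synthesis u)"
  obtains C where "0 < C" "\<And>v. norm v \<le> C * norm (analysis u v)"
proof -
  define E where "E n = {w. \<forall>v. norm (qinner v w) \<le> real n * norm (analysis u v)}" for n :: nat
  \<comment> \<open>Each \<open>E n\<close> is an intersection over \<open>v\<close> of sublevel
    sets of functions continuous in \<open>w\<close>.\<close>
  have closed: "closed (E n)" for n
    unfolding E_def
    by (intro closed_Collect_all closed_Collect_le continuous_intros
          bounded_linear.continuous_on[OF bounded_linear_qinner_right])
  have cover: "\<Union>(range E) = UNIV"
  proof -
    have "\<exists>n. w \<in> E n" for w
    proof -
      obtain q where w: "w = synthesis u q"
        using surj by blast
      obtain n where n: "norm q \<le> real n"
        using real_arch_simple by blast
      have "norm (qinner v w) \<le> real n * norm (analysis u v)" for v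
        using norm_qinner_le[of "analysis u v" q] mult_right_mono[OF n, of "norm (analysis u v)"]
        by (simp add: w qinner_synthesis mult.commute)
      then show ?thesis
        by (auto simp: E_def)
    qed
    then show ?thesis
      by blast
  qed
  have "\<exists>n. interior (E n) \<noteq> {}"
  proof (rule ccontr)
    assume "\<not> ?thesis"
    then have "Met_TC.mtopology interior_of \<Union>(range E) = {}"
      using closed complete_UNIV by (intro Met_TC.metric_Baire_category_alt) auto
    then show False
      by (simp add: cover)
  qed
  then obtain n w0 r where r: "0 < r" and ball: "ball w0 r \<subseteq> E n"
    by (metis ex_in_conv mem_interior)
  have "norm v \<le> (4 * real n / r) * norm (analysis u v)" for v
  proof (cases "v = 0")
    case False
    \<comment> \<open>This multiple of \<open>v\<close> has length \<open>r / 2\<close>, so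
      \<open>w0 + w\<close> stays in the ball; subtracting the estimates at \<open>w0 + w\<close>
      and \<open>w0\<close> bounds \<open>norm (qinner v w) = r / 2 * norm v\<close>.\<close>
    define w where "w = (r / (2 * norm v)) *\<^sub>R v"
    have "norm w = r / 2"
      using False r by (simp add: w_def)
    then have "w0 \<in> E n" "w0 + w \<in> E n"
      using ball r by (auto simp: subset_iff dist_norm)
    then have "norm (qinner v w0) \<le> n * norm (analysis u v)"
      "norm (qinner v w0 + qinner v w) \<le> n * norm (analysis u v)"
      by (auto simp: E_def qinner_add_right)
    then have "norm (qinner v w) \<le> 2 * n * norm (analysis u v)"
      using norm_triangle_ineq4[of "qinner v w0 + qinner v w" "qinner v w0"] by simp
    moreover have "norm (qinner v w) = r / 2 * norm v"
      using False r by (simp add: w_def qinner_scaleR_right power2_eq_square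
          flip: norm_sq_eq_norm_qinner)
    ultimately show ?thesis
      using r by (simp add: field_simps)
  qed (use r in simp)
  \<comment> \<open>Adding 1 makes the constant positive even when \<open>n = 0\<close>.\<close>
  then have "norm v \<le> (4 * real n / r + 1) * norm (analysis u v)" for v
    by (smt (verit) mult_right_mono norm_ge_zero)
  moreover have "0 < 4 * real n / r + 1"
    using r by (simp add: add_nonneg_pos)
  ultimately show ?thesis
    using that by blast
qed

end

section \<open>Bessel bounds from either side of the equivalence\<close>

text \<open>The operator is tested on the coefficients of \<open>v\<close> truncated to
  \<open>F\<close>: pairing the image with \<open>v\<close> returns the partial sum
  \<open>s\<close>, while the input has norm \<open>sqrt s\<close>. Hence \<open>s\<close> is at
  most \<open>\<bar>K\<bar> * norm v * sqrt s\<close>, and \<open>sqrt s\<close> cancels.\<close>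

lemma bessel_family_of_bounded_synthesis:
  assumes "bounded_right_linear (synthesis u)"
  obtains B where "bessel_family u B"
proof -
  obtain K where "\<And>q. norm (synthesis u q) \<le> K * norm q"
    using assms unfolding bounded_right_linear_def by blast
  then have K: "norm (synthesis u q) \<le> \<bar>K\<bar> * norm q" for q
    by (meson abs_ge_self mult_right_mono norm_ge_zero order_trans)
  have "(\<Sum>i\<in>F. (norm (qinner (u i) v))\<^sup>2) \<le> K\<^sup>2 * (norm v)\<^sup>2" if F: "finite F" for F v
  proof -
    define s where "s = (\<Sum>i\<in>F. (norm (qinner (u i) v))\<^sup>2)"
    define f where "f i = (if i \<in> F then qinner (u i) v else 0)" for i
    define q where "q = Abs_ell2 f"
    have s: "s \<ge> 0"
      by (simp add: s_def sum_nonneg)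
    have sq: "((\<lambda>i. (norm (f i))\<^sup>2) has_sum s) UNIV"
      unfolding s_def
      by (rule has_sum_finite_neutralI[OF F]) (auto simp: f_def)
    then have nth: "ell2_nth q = f"
      unfolding q_def by (simp add: Abs_ell2_inverse has_sum_imp_summable)
    have "synthesis u q = (\<Sum>i\<in>F. u i *\<^sub>Q qinner (u i) v)"
      unfolding synthesis_def nth
      by (rule infsumI, rule has_sum_finite_neutralI[OF F]) (auto simp: f_def)
    then have "qinner v (synthesis u q) = (\<Sum>i\<in>F. qinner v (u i) * qinner (u i) v)"
      using bounded_linear.linear[OF bounded_linear_qinner_right[of v]]
      by (simp add: linear_sum qinner_scaleQ_right)
    also have "\<dots> = of_real s"
      unfolding s_def of_real_sum
      by (intro sum.cong refl) (metis qinner_cnj qcnj_mult_self)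
    finally have "s \<le> norm v * norm (synthesis u q)"
      using norm_qinner_le[of v "synthesis u q"] s by simp
    also have "\<dots> \<le> norm v * (\<bar>K\<bar> * norm q)"
      by (intro mult_left_mono K) auto
    also have "norm q = sqrt s"
      by (simp add: norm_ell2_def nth infsumI[OF sq])
    finally have "sqrt s * sqrt s \<le> (\<bar>K\<bar> * norm v) * sqrt s"
      using s by (simp add: mult_ac)
    then have "sqrt s \<le> \<bar>K\<bar> * norm v"
      using s by (cases "s = 0") (auto dest: mult_right_le_imp_le simp del: real_sqrt_mult_self)
    then have "s \<le> (\<bar>K\<bar> * norm v)\<^sup>2"
      by (rule sqrt_le_D)
    then show ?thesis
      by (simp add: s_def power_mult_distrib)
  qed
  then have "bessel_family u (K\<^sup>2)"
    by unfold_locales auto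
  then show ?thesis
    by (rule that)
qed

text \<open>A sum in \<open>ennreal\<close> is the supremum of its finite partial sums, so each of
  these inherits the bound. Since \<open>ennreal\<close> sends negative reals to 0, \<open>B\<close>
  must be nonnegative to return to real inequalities.\<close>

lemma bessel_family_of_frame_bound:
  fixes u :: "'i \<Rightarrow> 'v::right_quaternionic_hilbert"
  assumes B: "0 \<le> B"
    and upper: "\<And>v. (\<Sum>\<^sub>\<infinity>i. ennreal ((norm (qinner (u i) v))\<^sup>2)) \<le> ennreal (B * (norm v)\<^sup>2)"
  shows "bessel_family u B"
proof
  fix F :: "'i set" and v
  assume F: "finite F"
  have "ennreal (\<Sum>i\<in>F. (norm (qinner (u i) v))\<^sup>2)
      \<le> (SUP F\<in>{F. finite F \<and> F \<subseteq> UNIV}. \<Sum>i\<in>F. ennreal ((norm (qinner (u i) v))\<^sup>2))"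
    using F by (intro SUP_upper2[of F]) auto
  also have "\<dots> \<le> ennreal (B * (norm v)\<^sup>2)"
    using upper[of v] by (simp add: nonneg_infsum_complete)
  finally show "(\<Sum>i\<in>F. (norm (qinner (u i) v))\<^sup>2) \<le> B * (norm v)\<^sup>2"
    using B by (simp add: ennreal_le_iff)
qed (rule B)

text \<open>Once summability is known, the extended and the real sum are the same supremum; the
  frame inequalities become norm bounds on \<open>analysis u\<close>.\<close>

lemma (in bessel_family) infsum_ennreal_analysis:
  "(\<Sum>\<^sub>\<infinity>i. ennreal ((norm (qinner (u i) v))\<^sup>2)) = ennreal ((norm (analysis u v))\<^sup>2)"
  unfolding norm_analysis_sq
  by (subst infsum_nonneg_is_SUPREMUM_ennreal[OF analysis_summable])
    (simp_all add: nonneg_infsum_complete)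

theorem theorem3p12:
  fixes u :: "'i \<Rightarrow> 'v::right_quaternionic_hilbert"
  assumes "separable_space (euclidean :: 'v topology)"
  shows "is_frame u \<longleftrightarrow>
           synthesis_well_defined u \<and> bounded_right_linear (synthesis u) \<and> surj (synthesis u)"
proof
  assume "is_frame u"
  then obtain A B where A: "0 < A" "A \<le> B"
    and lower: "\<And>v. ennreal (A * (norm v)\<^sup>2) \<le> (\<Sum>\<^sub>\<infinity>i. ennreal ((norm (qinner (u i) v))\<^sup>2))"
    and upper: "\<And>v. (\<Sum>\<^sub>\<infinity>i. ennreal ((norm (qinner (u i) v))\<^sup>2)) \<le> ennreal (B * (norm v)\<^sup>2)"
    unfolding is_frame_def by blast
  interpret bessel_family u B
    using A upper by (intro bessel_family_of_frame_bound) auto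
  have "surj (synthesis u)"
    using surj_synthesis[OF A] lower by (simp add: infsum_ennreal_analysis ennreal_le_iff)
  then show "synthesis_well_defined u \<and> bounded_right_linear (synthesis u) \<and> surj (synthesis u)"
    using synthesis_summable bounded_right_linear_synthesis
    by (simp add: synthesis_well_defined_def)
next
  assume *: "synthesis_well_defined u \<and> bounded_right_linear (synthesis u) \<and> surj (synthesis u)"
  then obtain B where "bessel_family u B"
    using bessel_family_of_bounded_synthesis by blast
  then interpret bessel_family u B .
  obtain C where C: "0 < C" "\<And>v. norm v \<le> C * norm (analysis u v)"
    using analysis_bounded_below * by blast
  have lower: "1 / C\<^sup>2 * (norm v)\<^sup>2 \<le> (norm (analysis u v))\<^sup>2" for v
    using power_mono[OF C(2)[of v], of 2] C(1) by (simp add: power_mult_distrib field_simps)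
  \<comment> \<open>The maximum secures the required order of the two frame constants; in the zero
    space the Bessel bound \<open>B\<close> may lie below \<open>1 / C\<^sup>2\<close>.\<close>
  have upper: "(norm (analysis u v))\<^sup>2 \<le> max B (1 / C\<^sup>2) * (norm v)\<^sup>2" for v
    using norm_analysis_sq_le[of v] mult_right_mono[of B "max B (1 / C\<^sup>2)" "(norm v)\<^sup>2"] by simp
  show "is_frame u"
    unfolding is_frame_def infsum_ennreal_analysis
    using C(1) lower upper
    by (intro exI[of _ "1 / C\<^sup>2"] exI[of _ "max B (1 / C\<^sup>2)"]) (auto intro: ennreal_leI)
qed

end
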